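(* Let $t\in\{2,\dots,T\}$ and let the decision-dependent ambiguity set be the Wasserstein ball $$\mathcal{P}_t(x_{t-1})=\{P_t\in\mathcal{M}(\Omega_t):\ \mathcal{W}(P_t,\bar P_t)\le\epsilon_t(x_{t-1})\}$$ with $\epsilon_t(x_{t-1})>0$, where $\bar P_t=\frac1{N_t}\sum_{i=1}^{N_t}\delta_{\omega_t^i}$. Then the optimistic expected cost-to-go function $\mathcal{Q}^{RR}_t(x_{t-1})=\min_{P_t\in\mathcal{P}_t(x_{t-1})}\mathbb{E}_{P_t}[Q^{RR}_t(x_{t-1},\boldsymbol{\omega}_t)]$ satisfies $$\mathcal{Q}^{RR}_t(x_{t-1})=\max_{\rho_t\ge0}\Big\{-\epsilon_t(x_{t-1})\,\rho_t+\sum_{i=1}^{N_t}\frac1{N_t}\min_{\omega_t\in\Omega_t}\big\{\rho_t\|\omega_t-\omega_t^i\|+Q^{RR}_t(x_{t-1},\omega_t)\big\}\Big\}.$$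
   Context: Distributionally risk-receptive multistage stochastic integer program with $T$ stages and decision-dependent ambiguity sets. Here $x_t$ denotes the vector of all decision variables of stage $t$. For each $t\in\{2,\dots,T\}$, $\boldsymbol{\omega}_t$ is a random vector with continuous (not necessarily finite) support $\Omega_t\subseteq\mathbb{R}^{d_\omega}$; random vectors are stage-wise independent; $\omega_t^1,\dots,\omega_t^{N_t}\in\Omega_t$ are given data points. $\delta_\omega$ is the Dirac measure at $\omega$. $\mathcal{M}(\Omega_t)$ is the set of all probability distributions supported on $\Omega_t$, $\|\cdot\|$ is an arbitrary norm, and $\mathcal{W}$ is the 1-Wasserstein distance $$\mathcal{W}(P_t,\bar P_t)=\inf_{P}\Big\{\mathbb{E}_{P}\big[\|\omega_t-\omega_t'\|\big]\Big\},$$ the infimum being over all joint probability distributions $P$ on $\Omega_t\times\Omega_t$ of $(\omega_t,\omega_t')$ with first marginal $P_t$ and second marginal $\bar P_t$. The cost-to-go functions are defined recursively by $$Q^{RR}_t(x_{t-1},\omega_t)=\min_{x_t\in X_t(x_{t-1},\omega_t)}\Big\{f_t(x_t,\omega_t)+\min_{P_{t+1}\in\mathcal{P}_{t+1}(x_t)}\mathbb{E}_{P_{t+1}}[Q^{RR}_{t+1}(x_t,\boldsymbol{\omega}_{t+1})]\Big\},\quad t=2,\dots,T,\qquad Q^{RR}_{T+1}=0,$$ where $X_t(x_{t-1},\omega_t)$ is a nonempty compact mixed-integer set and $f_t(\cdot,\omega_t)$ is linear. "min" and "max" denote the optimal values of the respective optimization problems (infimum/supremum), and all expectations are taken to be well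 defined, as the notation presupposes. *)

theory Defs
  imports "HOL-Probability.Probability"
begin

definition is_norm :: "('a::real_vector \<Rightarrow> real) \<Rightarrow> bool" where
  "is_norm nrm \<longleftrightarrow>
     (\<forall>v. 0 \<le> nrm v) \<and>
     (\<forall>v. nrm v = 0 \<longleftrightarrow> v = 0) \<and>
     (\<forall>c v. nrm (c *\<^sub>R v) = \<bar>c\<bar> * nrm v) \<and>
     (\<forall>v w. nrm (v + w) \<le> nrm v + nrm w)"


subsection \<open>Probability distributions on a support set, and the Wasserstein distance\<close>

text \<open>A set \<open>S\<close> carries the trace of the Borel sigma-algebra; it need not itself be a Borel set.\<close>

abbreviation borel_on :: "'a::topological_space set \<Rightarrow> 'a measure" where
  "borel_on S \<equiv> restrict_space borel S"

definition prob_distributions :: "'a::topological_space set \<Rightarrow> 'a measure set" where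
  "prob_distributions S = {P. prob_space P \<and> sets P = sets (borel_on S)}"

definition couplings :: "'a::topological_space set \<Rightarrow> 'a measure \<Rightarrow> 'a measure \<Rightarrow> ('a \<times> 'a) measure set" where
  "couplings S P P' =
     {J. prob_space J \<and> sets J = sets (borel_on S \<Otimes>\<^sub>M borel_on S) \<and>
         distr J (borel_on S) fst = P \<and> distr J (borel_on S) snd = P'}"

definition wasserstein :: "('a::{topological_space,minus} \<Rightarrow> real) \<Rightarrow> 'a set \<Rightarrow> 'a measure \<Rightarrow> 'a measure \<Rightarrow> ennreal" where
  "wasserstein nrm S P P' =
     (INF J \<in> couplings S P P'. \<integral>\<^sup>+ (w, w'). ennreal (nrm (w - w')) \<partial>J)"

definition wasserstein_ball :: "('a::{topological_space,minus} \<Rightarrow> real) \<Rightarrow> 'a set \<Rightarrow> 'a measure \<Rightarrow> real \<Rightarrow> 'a measure set" where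
  "wasserstein_ball nrm S P' \<epsilon> = {P \<in> prob_distributions S. wasserstein nrm S P P' \<le> ennreal \<epsilon>}"

text \<open>The measure \<open>(1/N) (\<delta>\<^bsub>w 1\<^esub> + \<dots> + \<delta>\<^bsub>w N\<^esub>)\<close>; \<open>return M a\<close> is the Dirac measure at \<open>a\<close>.\<close>

definition empirical :: "'a::topological_space set \<Rightarrow> nat \<Rightarrow> (nat \<Rightarrow> 'a) \<Rightarrow> 'a measure" where
  "empirical S N w =
     measure_of (space (borel_on S)) (sets (borel_on S))
       (\<lambda>A. \<Sum>i = 1..N. ennreal (1 / real N) * emeasure (return (borel_on S) (w i)) A)"

lemma sets_empirical [simp, measurable_cong]: "sets (empirical S N w) = sets (borel_on S)"
  unfolding empirical_def by (rule sets.sets_measure_of_eq)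

lemma emeasure_empirical:
  assumes "A \<in> sets (borel_on S)"
  shows "emeasure (empirical S N w) A =
    (\<Sum>i = 1..N. ennreal (1 / real N) * emeasure (return (borel_on S) (w i)) A)"
proof (rule emeasure_measure_of[OF empirical_def])
  let ?\<mu> = "\<lambda>A. \<Sum>i = 1..N. ennreal (1 / real N) * emeasure (return (borel_on S) (w i)) A"
  show "sets (borel_on S) \<subseteq> Pow (space (borel_on S))" by (rule sets.space_closed)
  show "A \<in> sets (empirical S N w)" using assms by simp
  show "positive (sets (empirical S N w)) ?\<mu>" by (simp add: positive_def)
  show "countably_additive (sets (empirical S N w)) ?\<mu>"
  proof (rule countably_additiveI)
    fix B :: "nat \<Rightarrow> _"
    assume B: "range B \<subseteq> sets (empirical S N w)" "disjoint_family B"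
    then have "range B \<subseteq> sets (return (borel_on S) (w i))" for i by simp
    then have "(\<Sum>k. emeasure (return (borel_on S) (w i)) (B k)) =
        emeasure (return (borel_on S) (w i)) (\<Union>k. B k)" for i
      using B(2) by (rule suminf_emeasure)
    then show "(\<Sum>k. ?\<mu> (B k)) = ?\<mu> (\<Union>k. B k)"
      by (subst suminf_sum) auto
  qed
qed

lemma prob_space_empirical:
  assumes "N \<ge> 1" "\<And>i. i \<in> {1..N} \<Longrightarrow> w i \<in> S"
  shows "empirical S N w \<in> prob_distributions S"
proof -
  have sp: "space (empirical S N w) = S"
    using sets_eq_imp_space_eq[OF sets_empirical] by (simp add: space_restrict_space)
  have S: "S \<in> sets (borel_on S)"
    using sets.top[of "borel_on S"] by (simp add: space_restrict_space)
  have "emeasure (empirical S N w) S = (\<Sum>i = 1..N. ennreal (1 / real N))"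
    using assms S by (auto simp: emeasure_empirical intro!: sum.cong)
  also have "\<dots> = ennreal (\<Sum>i = 1..N. 1 / real N)"
    by (rule sum_ennreal) simp
  also have "\<dots> = 1"
    using assms(1) by simp
  finally show ?thesis
    by (auto simp: prob_distributions_def sp intro!: prob_spaceI)
qed


subsection \<open>Expectations of extended-real functions\<close>

text \<open>\<open>E[g] = E[g\<^sup>+] - E[g\<^sup>-]\<close>; it is well defined unless both parts are infinite. The map
  \<open>e2ennreal\<close> sends negative arguments to \<open>0\<close>, so it takes the positive part.\<close>

definition ereal_expectation :: "'a measure \<Rightarrow> ('a \<Rightarrow> ereal) \<Rightarrow> ereal" where
  "ereal_expectation P g =
     enn2ereal (\<integral>\<^sup>+ w. e2ennreal (g w) \<partial>P) - enn2ereal (\<integral>\<^sup>+ w. e2ennreal (- g w) \<partial>P)"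

definition expectation_well_defined :: "'a measure \<Rightarrow> ('a \<Rightarrow> ereal) \<Rightarrow> bool" where
  "expectation_well_defined P g \<longleftrightarrow>
     g \<in> borel_measurable P \<and>
     \<not> ((\<integral>\<^sup>+ w. e2ennreal (g w) \<partial>P) = \<infinity> \<and> (\<integral>\<^sup>+ w. e2ennreal (- g w) \<partial>P) = \<infinity>)"

lemma ereal_expectation_eq_integral:
  assumes "integrable P g"
  shows "ereal_expectation P (\<lambda>w. ereal (g w)) = ereal (\<integral>w. g w \<partial>P)"
proof -
  have fin: "(\<integral>\<^sup>+ w. ennreal (g w) \<partial>P) \<noteq> \<infinity>" "(\<integral>\<^sup>+ w. ennreal (- g w) \<partial>P) \<noteq> \<infinity>"
    using assms by (auto simp: real_integrable_def)
  have conv: "enn2ereal a = ereal (enn2real a)" if "a \<noteq> \<infinity>" for a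
    using that by (cases a) (auto simp: enn2ereal_ennreal)
  show ?thesis
    using fin by (simp add: ereal_expectation_def conv real_lebesgue_integral_def[OF assms])
qed


subsection \<open>The multistage program\<close>

text \<open>Decision vectors of a stage with \<open>n\<close> decision variables are the points of
  \<open>Euclidean_space n\<close>, i.e. the sequences vanishing from index \<open>n\<close> on; so the dimension may
  differ from stage to stage.\<close>

type_synonym dvec = "nat \<Rightarrow> real"

definition linear_on_Rn :: "nat \<Rightarrow> (dvec \<Rightarrow> real) \<Rightarrow> bool" where
  "linear_on_Rn n g \<longleftrightarrow>
     (\<forall>x \<in> topspace (Euclidean_space n). \<forall>y \<in> topspace (Euclidean_space n). \<forall>a b.
        g (\<lambda>i. a * x i + b * y i) = a * g x + b * g y)"

text \<open>\<open>I\<close> is the set of indices of the integer variables.\<close>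

definition mixed_integer_set :: "nat \<Rightarrow> nat set \<Rightarrow> dvec set \<Rightarrow> bool" where
  "mixed_integer_set n I X \<longleftrightarrow> X \<subseteq> {x \<in> topspace (Euclidean_space n). \<forall>i \<in> I. x i \<in> \<int>}"

text \<open>\<open>Q_RR T X f Amb t x w\<close> is the cost-to-go function of stage \<open>t\<close> at the previous decision \<open>x\<close>
  and the realization \<open>w\<close>, for feasible sets \<open>X\<close>, costs \<open>f\<close> and ambiguity sets \<open>Amb\<close>.
  No ambiguity set is given for stage \<open>T + 1\<close>, so the expectation of the zero cost-to-go
  function of that stage is written as \<open>0\<close>.\<close>

function Q_RR :: "nat \<Rightarrow> (nat \<Rightarrow> dvec \<Rightarrow> 'w \<Rightarrow> dvec set) \<Rightarrow> (nat \<Rightarrow> dvec \<Rightarrow> 'w \<Rightarrow> real)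
    \<Rightarrow> (nat \<Rightarrow> dvec \<Rightarrow> 'w measure set) \<Rightarrow> nat \<Rightarrow> dvec \<Rightarrow> 'w \<Rightarrow> ereal" where
  "Q_RR T X f Amb t x w =
     (if t > T then 0
      else INF y \<in> X t x w. ereal (f t y w) +
        (if t = T then 0
         else INF P \<in> Amb (Suc t) y. ereal_expectation P (\<lambda>w'. Q_RR T X f Amb (Suc t) y w')))"
  by pat_completeness auto
termination
  by (relation "Wellfounded.measure (\<lambda>(T, X, f, Amb, t, x, w). Suc T - t)") auto

declare Q_RR.simps [simp del]

definition expected_Q_RR :: "nat \<Rightarrow> (nat \<Rightarrow> dvec \<Rightarrow> 'w \<Rightarrow> dvec set) \<Rightarrow> (nat \<Rightarrow> dvec \<Rightarrow> 'w \<Rightarrow> real)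
    \<Rightarrow> (nat \<Rightarrow> dvec \<Rightarrow> 'w measure set) \<Rightarrow> nat \<Rightarrow> dvec \<Rightarrow> ereal" where
  "expected_Q_RR T X f Amb t x = (INF P \<in> Amb t x. ereal_expectation P (Q_RR T X f Amb t x))"

lemma Q_RR_beyond: "T < t \<Longrightarrow> Q_RR T X f Amb t x w = 0"
  by (subst Q_RR.simps) simp

lemma Q_RR_last: "Q_RR T X f Amb T x w = (INF y \<in> X T x w. ereal (f T y w))"
  by (subst Q_RR.simps) simp

lemma Q_RR_step:
  "t < T \<Longrightarrow> Q_RR T X f Amb t x w =
     (INF y \<in> X t x w. ereal (f t y w) + expected_Q_RR T X f Amb (Suc t) y)"
  by (subst Q_RR.simps) (simp add: expected_Q_RR_def)

end

theory Submission
  imports Defs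
begin

text \<open>
  The identity is Lagrangian duality for the linear program of moving the empirical distribution
  within a transport budget \<open>\<epsilon>\<close>; \<open>\<rho>\<close> is the multiplier of the budget. The duality holds for
  every measurable \<open>Q\<close> that is nowhere \<open>+\<infinity>\<close> on the support (\<open>wasserstein_ball_duality\<close>). The
  cost-to-go functions are below \<open>+\<infinity>\<close> by backward induction on the stage, since the empirical
  distribution itself belongs to the ambiguity set (\<open>Q_RR_less_top\<close>).

  Weak duality (\<open>weak_duality\<close>): if \<open>\<phi> w'\<close> is the infimum over \<open>w\<close> of \<open>\<rho> \<parallel>w - w'\<parallel> + Q w\<close>, then
  \<open>Q w \<ge> \<phi> w' - \<rho> \<parallel>w - w'\<parallel>\<close>. Integrating this against a coupling of \<open>P\<close> with the empirical
  distribution whose cost is close to the Wasserstein distance bounds the expectation of \<open>Q\<close> under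
  \<open>P\<close> from below by \<open>- \<epsilon> \<rho>\<close> plus the average of the \<open>\<phi> (\<omega> i)\<close>.

  Strong duality (\<open>strong_duality\<close>): it suffices to look at very few distributions. A selection \<open>a\<close>
  moves each data point \<open>\<omega> i\<close> to a point \<open>a i\<close> of the support, at an average cost \<open>u a\<close> and with an
  average value \<open>v a\<close> of \<open>Q\<close>. A mixture of two selections \<open>a\<close> and \<open>b\<close> with weights \<open>l\<close> and \<open>1 - l\<close>
  lies in the ball as soon as \<open>l u a + (1 - l) u b \<le> \<epsilon>\<close>. So if \<open>L\<close> is a lower bound for the primal
  problem, no segment between two of the points \<open>(u a, v a)\<close> of the plane meets the quadrant of the
  points with first coordinate at most \<open>\<epsilon>\<close> and second coordinate below \<open>L\<close>. Leaving the data
  unmoved gives a point with \<open>u = 0 < \<epsilon>\<close>, which is Slater's condition, and \<open>planar_multiplier\<close> then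
  yields a line of finite slope \<open>- \<rho>\<close> through \<open>(\<epsilon>, L)\<close> below all the points: \<open>v a + \<rho> u a \<ge> L + \<rho> \<epsilon>\<close>
  for every selection. The coordinates \<open>a i\<close> of a selection can be minimised separately
  (\<open>sum_INF_ge\<close>), which turns \<open>v a + \<rho> u a\<close> into the average of the \<open>\<phi> (\<omega> i)\<close>; so the dual objective
  at \<open>\<rho>\<close> is at least \<open>L\<close>.

  If \<open>Q\<close> takes the value \<open>-\<infinity>\<close>, both sides are \<open>-\<infinity>\<close>: a small enough part of the mass can be moved
  to such a point within the budget.
\<close>

section \<open>Measurability of the transport cost\<close>

lemma is_norm_nonneg: "is_norm nrm \<Longrightarrow> 0 \<le> nrm v"
  by (simp add: is_norm_def)

text \<open>A norm is convex, and convex functions on a Euclidean space are continuous.\<close>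

lemma is_norm_measurable:
  fixes nrm :: "'a::euclidean_space \<Rightarrow> real"
  assumes "is_norm nrm"
  shows "nrm \<in> borel_measurable borel"
proof (rule borel_measurable_continuous_onI)
  have "convex_on UNIV nrm"
  proof (rule convex_onI)
    fix t :: real and v w :: 'a
    assume t: "0 < t" "t < 1"
    have "nrm ((1 - t) *\<^sub>R v + t *\<^sub>R w) \<le> nrm ((1 - t) *\<^sub>R v) + nrm (t *\<^sub>R w)"
      using assms unfolding is_norm_def by blast
    also have "\<dots> = (1 - t) * nrm v + t * nrm w"
      using assms t by (simp add: is_norm_def)
    finally show "nrm ((1 - t) *\<^sub>R v + t *\<^sub>R w) \<le> (1 - t) * nrm v + t * nrm w" .
  qed simp
  then show "continuous_on UNIV nrm"
    by (rule convex_on_continuous[OF open_UNIV])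
qed

lemma transport_cost_measurable:
  fixes nrm :: "'a::euclidean_space \<Rightarrow> real"
  assumes "is_norm nrm"
  shows "(\<lambda>z. nrm (fst z - snd z)) \<in> borel_measurable (borel_on S \<Otimes>\<^sub>M borel_on S)"
proof -
  have id: "(\<lambda>w. w) \<in> borel_on S \<rightarrow>\<^sub>M borel"
    by (rule measurable_restrict_space1) simp
  have "fst \<in> borel_on S \<Otimes>\<^sub>M borel_on S \<rightarrow>\<^sub>M borel"
    "snd \<in> borel_on S \<Otimes>\<^sub>M borel_on S \<rightarrow>\<^sub>M borel"
    using measurable_compose[OF measurable_fst id] measurable_compose[OF measurable_snd id]
    by auto
  then have "(\<lambda>z. fst z - snd z) \<in> borel_on S \<Otimes>\<^sub>M borel_on S \<rightarrow>\<^sub>M borel"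
    by (rule borel_measurable_diff)
  then show ?thesis
    by (rule measurable_compose[OF _ is_norm_measurable[OF assms]])
qed

section \<open>Discrete distributions as images of finite probability spaces\<close>

lemma measurable_pmf_borel_on:
  "(\<And>i. g i \<in> S) \<Longrightarrow> g \<in> measure_pmf p \<rightarrow>\<^sub>M borel_on S"
  by (simp add: space_restrict_space)

lemma empirical_cong:
  assumes "\<And>i. i \<in> {1..N} \<Longrightarrow> w i = w' i"
  shows "empirical S N w = empirical S N w'"
proof (rule measure_eqI)
  fix A assume "A \<in> sets (empirical S N w)"
  then show "emeasure (empirical S N w) A = emeasure (empirical S N w') A"
    using assms by (simp add: emeasure_empirical)
qed simp

text \<open>Writing the empirical distribution as the image of the uniform distribution on the indices reduces
  integrals with respect to it to finite sums, also when data points coincide.\<close>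

lemma empirical_eq_distr:
  assumes "N \<ge> 1" and w: "\<And>i. w i \<in> S"
  shows "empirical S N w = distr (measure_pmf (pmf_of_set {1..N})) (borel_on S) w"
proof (rule measure_eqI)
  fix A assume "A \<in> sets (empirical S N w)"
  then have A: "A \<in> sets (borel_on S)" by simp
  have "emeasure (empirical S N w) A = (\<Sum>i = 1..N. ennreal (1 / real N) * indicator A (w i))"
    using A by (simp add: emeasure_empirical)
  also have "\<dots> = (\<Sum>i = 1..N. ennreal (indicator A (w i) / real N))"
    by (intro sum.cong refl) (auto simp: indicator_def)
  also have "\<dots> = ennreal (\<Sum>i = 1..N. indicator A (w i) / real N)"
    by (rule sum_ennreal) simp
  also have "(\<Sum>i = 1..N. indicator A (w i) / real N) = real (card ({1..N} \<inter> w -` A)) / real N"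
    by (simp add: sum_divide_distrib[symmetric] indicator_def of_bool_def sum.If_cases vimage_def Int_def)
  also have "ennreal \<dots> = emeasure (measure_pmf (pmf_of_set {1..N})) (w -` A)"
    using assms(1) by (simp add: emeasure_pmf_of_set)
  also have "\<dots> = emeasure (distr (measure_pmf (pmf_of_set {1..N})) (borel_on S) w) A"
    using A by (simp add: emeasure_distr[OF measurable_pmf_borel_on[OF w]])
  finally show "emeasure (empirical S N w) A = \<dots>" .
qed simp

lemma distr_in_prob_distributions:
  assumes "\<And>i. g i \<in> S"
  shows "distr (measure_pmf p) (borel_on S) g \<in> prob_distributions S"
  unfolding prob_distributions_def
  by (simp add: measure_pmf.prob_space_distr[OF measurable_pmf_borel_on[OF assms]])

text \<open>The joint image under \<open>(g, h)\<close> of a common index distribution is a coupling of the two images.\<close>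

lemma wasserstein_distr_le:
  fixes nrm :: "'a::euclidean_space \<Rightarrow> real"
  assumes nrm: "is_norm nrm" and fin: "finite (set_pmf p)"
    and g: "\<And>i. g i \<in> S" and h: "\<And>i. h i \<in> S"
  shows "wasserstein nrm S (distr (measure_pmf p) (borel_on S) g) (distr (measure_pmf p) (borel_on S) h)
    \<le> ennreal (measure_pmf.expectation p (\<lambda>i. nrm (g i - h i)))"
proof -
  let ?J = "distr (measure_pmf p) (borel_on S \<Otimes>\<^sub>M borel_on S) (\<lambda>i. (g i, h i))"
  note mg = measurable_pmf_borel_on[of g, OF g] and mh = measurable_pmf_borel_on[of h, OF h]
  have mgh: "(\<lambda>i. (g i, h i)) \<in> measure_pmf p \<rightarrow>\<^sub>M borel_on S \<Otimes>\<^sub>M borel_on S"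
    by (rule measurable_Pair[OF mg mh])
  have "?J \<in> couplings S (distr (measure_pmf p) (borel_on S) g) (distr (measure_pmf p) (borel_on S) h)"
    unfolding couplings_def
    by (simp add: measure_pmf.prob_space_distr[OF mgh] distr_distr[OF _ mgh] comp_def)
  then have "wasserstein nrm S (distr (measure_pmf p) (borel_on S) g) (distr (measure_pmf p) (borel_on S) h)
      \<le> (\<integral>\<^sup>+ (w, w'). ennreal (nrm (w - w')) \<partial>?J)"
    unfolding wasserstein_def by (rule INF_lower)
  also have "\<dots> = (\<integral>\<^sup>+ i. ennreal (nrm (g i - h i)) \<partial>measure_pmf p)"
    using transport_cost_measurable[OF nrm, of S]
    by (subst nn_integral_distr[OF mgh]) (simp_all add: case_prod_beta)
  also have "\<dots> = ennreal (measure_pmf.expectation p (\<lambda>i. nrm (g i - h i)))"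
    by (rule nn_integral_eq_integral)
      (simp_all add: fin integrable_measure_pmf_finite is_norm_nonneg[OF nrm])
  finally show ?thesis .
qed

text \<open>The index \<open>(c, i)\<close> records by \<open>c\<close> which of two selections is used, \<open>True\<close> having probability \<open>l\<close>,
  and by \<open>i\<close> which data point is moved. Keeping \<open>i\<close> visible makes the pairing of a moved point with
  its data point a coupling.\<close>

definition mixture_pmf :: "nat \<Rightarrow> real \<Rightarrow> (bool \<times> nat) pmf" where
  "mixture_pmf N l = pair_pmf (bernoulli_pmf l) (pmf_of_set {1..N})"

definition mixture :: "'a::topological_space set \<Rightarrow> nat \<Rightarrow> real \<Rightarrow> (nat \<Rightarrow> 'a) \<Rightarrow> (nat \<Rightarrow> 'a) \<Rightarrow> 'a measure" where
  "mixture S N l a b =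
     distr (measure_pmf (mixture_pmf N l)) (borel_on S) (\<lambda>(c, i). if c then a i else b i)"

lemma finite_set_mixture_pmf: "N \<ge> 1 \<Longrightarrow> finite (set_pmf (mixture_pmf N l))"
  by (simp add: mixture_pmf_def)

lemma expectation_mixture_pmf:
  fixes h :: "bool \<times> nat \<Rightarrow> real"
  assumes "N \<ge> 1" "0 \<le> l" "l \<le> 1"
  shows "measure_pmf.expectation (mixture_pmf N l) h =
    l * ((\<Sum>i = 1..N. h (True, i)) / N) + (1 - l) * ((\<Sum>i = 1..N. h (False, i)) / N)"
proof -
  have "measure_pmf.expectation (mixture_pmf N l) h =
      (\<Sum>z \<in> UNIV \<times> {1..N}. pmf (mixture_pmf N l) z * h z)"
    using assms by (subst integral_measure_pmf[of "UNIV \<times> {1..N}"]) (auto simp: mixture_pmf_def)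
  also have "\<dots> = (\<Sum>c\<in>UNIV. \<Sum>i = 1..N. pmf (mixture_pmf N l) (c, i) * h (c, i))"
    by (simp add: sum.cartesian_product)
  also have "\<dots> = l * ((\<Sum>i = 1..N. h (True, i)) / N) + (1 - l) * ((\<Sum>i = 1..N. h (False, i)) / N)"
    using assms
    by (simp add: UNIV_bool mixture_pmf_def pmf_pair sum_distrib_left sum_divide_distrib)
  finally show ?thesis .
qed

text \<open>The second component of the index distribution is uniform, so that the pairs of \<open>a i\<close> or \<open>b i\<close>
  with \<open>\<omega> i\<close> couple the mixture with the empirical distribution.\<close>

lemma mixture_in_wasserstein_ball:
  fixes nrm :: "'a::euclidean_space \<Rightarrow> real"
  assumes nrm: "is_norm nrm" and N: "N \<ge> 1" and l: "0 \<le> l" "l \<le> 1"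
    and \<omega>: "\<And>i. \<omega> i \<in> S" and a: "\<And>i. a i \<in> S" and b: "\<And>i. b i \<in> S"
    and cost: "l * ((\<Sum>i = 1..N. nrm (a i - \<omega> i)) / N) +
      (1 - l) * ((\<Sum>i = 1..N. nrm (b i - \<omega> i)) / N) \<le> \<epsilon>"
  shows "mixture S N l a b \<in> wasserstein_ball nrm S (empirical S N \<omega>) \<epsilon>"
proof -
  let ?g = "\<lambda>(c, i). if c then a i else b i"
  let ?h = "\<lambda>z. \<omega> (snd z)"
  have g: "?g z \<in> S" for z using a b by (auto split: prod.split)
  have h: "?h z \<in> S" for z :: "bool \<times> nat" using \<omega> by simp
  have "measure_pmf (pmf_of_set {1..N}) = measure_pmf (map_pmf snd (mixture_pmf N l))"
    by (simp add: mixture_pmf_def map_snd_pair_pmf)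
  also have "\<dots> = distr (measure_pmf (mixture_pmf N l)) (count_space UNIV) snd"
    by (rule map_pmf_rep_eq)
  finally have emp: "empirical S N \<omega> = distr (measure_pmf (mixture_pmf N l)) (borel_on S) ?h"
    using N \<omega> by (simp add: empirical_eq_distr distr_distr comp_def space_restrict_space)
  have "wasserstein nrm S (mixture S N l a b) (empirical S N \<omega>) \<le>
      ennreal (measure_pmf.expectation (mixture_pmf N l) (\<lambda>z. nrm (?g z - ?h z)))"
    unfolding mixture_def emp
    by (rule wasserstein_distr_le[OF nrm finite_set_mixture_pmf[OF N] g h])
  also have "\<dots> \<le> ennreal \<epsilon>"
    using cost by (intro ennreal_leI) (simp add: expectation_mixture_pmf[OF N l])
  finally show ?thesis
    unfolding wasserstein_ball_def mixture_def
    using distr_in_prob_distributions[of ?g S, OF g] by simp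
qed

lemma empirical_in_wasserstein_ball:
  fixes nrm :: "'a::euclidean_space \<Rightarrow> real"
  assumes nrm: "is_norm nrm" and "N \<ge> 1" "\<And>i. \<omega> i \<in> S" "\<epsilon> \<ge> 0"
  shows "empirical S N \<omega> \<in> wasserstein_ball nrm S (empirical S N \<omega>) \<epsilon>"
proof -
  let ?p = "pmf_of_set {1..N}"
  have "nrm 0 = 0" using nrm by (simp add: is_norm_def)
  then have "wasserstein nrm S (empirical S N \<omega>) (empirical S N \<omega>) \<le> 0"
    using wasserstein_distr_le[OF nrm, of ?p \<omega> S \<omega>] assms by (simp add: empirical_eq_distr)
  then show ?thesis
    using prob_space_empirical[of N \<omega> S] assms by (simp add: wasserstein_ball_def)
qed

section \<open>Expectations under discrete distributions\<close>

lemma ereal_expectation_cong_real: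
  assumes P: "sets P = sets (borel_on S)" and "\<And>w. w \<in> S \<Longrightarrow> Q w = ereal (q w)"
  shows "ereal_expectation P Q = ereal_expectation P (\<lambda>w. ereal (q w))"
proof -
  have "space P = S"
    using sets_eq_imp_space_eq[OF P] by (simp add: space_restrict_space)
  then show ?thesis
    using assms(2) unfolding ereal_expectation_def
    by (intro arg_cong2[where f = "(-)"] arg_cong[where f = enn2ereal] nn_integral_cong) auto
qed

lemma ereal_expectation_mixture:
  assumes N: "N \<ge> 1" and l: "0 \<le> l" "l \<le> 1" and a: "\<And>i. a i \<in> S" and b: "\<And>i. b i \<in> S"
    and q: "q \<in> borel_measurable (borel_on S)"
  shows "ereal_expectation (mixture S N l a b) (\<lambda>w. ereal (q w)) =
    ereal (l * ((\<Sum>i = 1..N. q (a i)) / N) + (1 - l) * ((\<Sum>i = 1..N. q (b i)) / N))"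
proof -
  let ?g = "\<lambda>(c, i). if c then a i else b i"
  have g: "?g \<in> measure_pmf (mixture_pmf N l) \<rightarrow>\<^sub>M borel_on S"
    using a b by (intro measurable_pmf_borel_on) (auto split: prod.split)
  have "integrable (mixture S N l a b) q"
    unfolding mixture_def integrable_distr_eq[OF g q]
    by (simp add: finite_set_mixture_pmf[OF N] integrable_measure_pmf_finite)
  then show ?thesis
    by (subst ereal_expectation_eq_integral)
      (simp_all add: mixture_def integral_distr[OF g q] expectation_mixture_pmf[OF N l])
qed

lemma nn_integral_distr_finite_less_top:
  fixes F :: "'a::topological_space \<Rightarrow> ennreal"
  assumes "finite (set_pmf p)" "\<And>i. g i \<in> S" "F \<in> borel_measurable (borel_on S)"
    "\<And>w. w \<in> S \<Longrightarrow> F w < top"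
  shows "(\<integral>\<^sup>+ w. F w \<partial>distr (measure_pmf p) (borel_on S) g) < top"
  using assms
  by (simp add: nn_integral_distr[OF measurable_pmf_borel_on] nn_integral_measure_pmf_finite
      ennreal_mult_less_top less_top)

lemma nn_integral_distr_eq_top:
  fixes F :: "'a::topological_space \<Rightarrow> ennreal"
  assumes "finite (set_pmf p)" "\<And>i. g i \<in> S" "F \<in> borel_measurable (borel_on S)"
    "i \<in> set_pmf p" "F (g i) = top"
  shows "(\<integral>\<^sup>+ w. F w \<partial>distr (measure_pmf p) (borel_on S) g) = top"
proof -
  have "F (g i) * ennreal (pmf p i) = top"
    using assms(4,5) by (simp add: ennreal_top_mult pmf_positive_iff[symmetric])
  moreover have "F (g i) * ennreal (pmf p i) \<le> (\<Sum>i\<in>set_pmf p. F (g i) * ennreal (pmf p i))"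
    using assms(1,4) by (intro member_le_sum) auto
  ultimately show ?thesis
    using assms
    by (simp add: nn_integral_distr[OF measurable_pmf_borel_on] nn_integral_measure_pmf_finite
       top_unique)
qed

text \<open>The positive part of \<open>Q\<close> has a finite integral, being a finite sum of finite values; the
  expectation may be \<open>-\<infinity>\<close>.\<close>

lemma ereal_expectation_empirical_less_top:
  assumes "N \<ge> 1" "\<And>i. \<omega> i \<in> S" "Q \<in> borel_measurable (borel_on S)"
    "\<And>w. w \<in> S \<Longrightarrow> Q w < \<infinity>"
  shows "ereal_expectation (empirical S N \<omega>) Q < \<infinity>"
proof -
  have fin: "e2ennreal (Q w) < top" if "w \<in> S" for w
    using assms(4)[OF that] by (cases "Q w") (auto simp: e2ennreal_neg)
  have "(\<integral>\<^sup>+ w. e2ennreal (Q w) \<partial>empirical S N \<omega>) < top"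
    using nn_integral_distr_finite_less_top[of "pmf_of_set {1..N}" \<omega> S "\<lambda>w. e2ennreal (Q w)"]
      assms fin by (simp add: empirical_eq_distr)
  then show ?thesis
    unfolding ereal_expectation_def
    by (cases "\<integral>\<^sup>+ w. e2ennreal (Q w) \<partial>empirical S N \<omega>";
        cases "\<integral>\<^sup>+ w. e2ennreal (- Q w) \<partial>empirical S N \<omega>") (auto simp: enn2ereal_ennreal)
qed

section \<open>Weak duality\<close>

text \<open>The sum of \<open>\<infinity>\<close> and \<open>-\<infinity>\<close> is \<open>\<infinity>\<close> in the extended reals, so a single summand \<open>-\<infinity>\<close> determines
  the sum only if none of the others is \<open>\<infinity>\<close>.\<close>

lemma ereal_weighted_sum_MInfty:
  fixes h :: "nat \<Rightarrow> ereal"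
  assumes "j \<in> {1..N}" "h j = -\<infinity>" "\<And>i. i \<in> {1..N} \<Longrightarrow> h i < \<infinity>"
  shows "(\<Sum>i = 1..N. ereal (1 / real N) * h i) = -\<infinity>"
proof -
  have N: "N > 0" using assms(1) by auto
  have lt: "ereal (1 / real N) * h i < \<infinity>" if "i \<in> {1..N}" for i
    using assms(3)[OF that] N by (cases "h i") auto
  have "(\<Sum>i \<in> {1..N} - {j}. ereal (1 / real N) * h i) \<noteq> \<infinity>"
    using lt by (auto simp only: sum_Pinfty) force
  moreover have "ereal (1 / real N) * h j = -\<infinity>"
    using assms(2) N by simp
  ultimately show ?thesis
    by (subst sum.remove[OF _ assms(1)]) (simp_all del: One_nat_def)
qed

text \<open>The inequality \<open>q w \<ge> \<psi> w' - \<rho> \<parallel>w - w'\<parallel>\<close> is integrated over the coupling. It holds for data points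
  \<open>w'\<close> only, which is enough as the second marginal is concentrated on them. The lower bound is
  integrable; hence \<open>q\<close> is integrable or has expectation \<open>\<infinity>\<close>.\<close>

lemma weak_duality_coupling:
  fixes nrm :: "'a::euclidean_space \<Rightarrow> real" and q :: "'a \<Rightarrow> real"
  assumes nrm: "is_norm nrm" and N: "N \<ge> 1" and \<omega>: "\<And>i. \<omega> i \<in> S" and \<rho>: "\<rho> \<ge> 0"
    and q: "q \<in> borel_measurable (borel_on S)"
    and J: "J \<in> couplings S P (empirical S N \<omega>)"
    and cost: "(\<integral>\<^sup>+ (w, w'). ennreal (nrm (w - w')) \<partial>J) \<le> ennreal c" "c \<ge> 0"
    and \<psi>: "\<And>w i. w \<in> S \<Longrightarrow> i \<in> {1..N} \<Longrightarrow> \<psi> (\<omega> i) \<le> \<rho> * nrm (w - \<omega> i) + q w"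
  shows "ereal (- c * \<rho> + (\<Sum>i = 1..N. \<psi> (\<omega> i)) / N) \<le> ereal_expectation P (\<lambda>w. ereal (q w))"
proof -
  have setsJ: "sets J = sets (borel_on S \<Otimes>\<^sub>M borel_on S)"
    and P: "P = distr J (borel_on S) fst"
    and emp: "empirical S N \<omega> = distr J (borel_on S) snd"
    using J by (auto simp: couplings_def)
  have mfst: "fst \<in> J \<rightarrow>\<^sub>M borel_on S" and msnd: "snd \<in> J \<rightarrow>\<^sub>M borel_on S"
    by (simp_all add: measurable_cong_sets[OF setsJ refl])
  have spaceJ: "space J = S \<times> S"
    using sets_eq_imp_space_eq[OF setsJ] by (simp add: space_pair_measure space_restrict_space)
  have mcost: "(\<lambda>z. nrm (fst z - snd z)) \<in> borel_measurable J"
    using transport_cost_measurable[OF nrm, of S] by (simp add: measurable_cong_sets[OF setsJ refl])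
  have cost': "(\<integral>\<^sup>+ z. ennreal (nrm (fst z - snd z)) \<partial>J) \<le> ennreal c"
    using cost(1) by (simp add: split_beta')
  have icost: "integrable J (\<lambda>z. nrm (fst z - snd z))"
    by (rule integrableI_bounded[OF mcost])
      (simp add: is_norm_nonneg[OF nrm] le_less_trans[OF cost'])
  have lcost: "(\<integral>z. nrm (fst z - snd z) \<partial>J) \<le> c"
    by (rule integral_real_bounded[OF cost(2) cost'])
  \<comment> \<open>No measurability of \<open>\<psi>\<close> is known. Changing it to \<open>0\<close> off the finite set of data points gives a
    measurable function with the same values almost everywhere.\<close>
  let ?D = "\<omega> ` {1..N}"
  let ?\<psi> = "\<lambda>w. if w \<in> ?D then \<psi> w else 0"
  have DS: "?D \<subseteq> S" using \<omega> by auto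
  have fin_sets: "F \<in> sets (borel_on S)" if "finite F" "F \<subseteq> S" for F
  proof -
    have "F = S \<inter> F" "F \<in> sets borel"
      using that by (auto intro!: borel_closed finite_imp_closed)
    then show ?thesis
      unfolding sets_restrict_space by (rule image_eqI)
  qed
  have D: "?D \<in> sets (borel_on S)"
    using DS by (intro fin_sets) auto
  have m\<psi>: "?\<psi> \<in> borel_measurable (borel_on S)"
    by (rule measurable_discrete_difference[of "\<lambda>_. 0" _ _ ?D])
      (use fin_sets DS in \<open>auto intro: countable_finite\<close>)
  have m\<omega>: "\<omega> \<in> measure_pmf (pmf_of_set {1..N}) \<rightarrow>\<^sub>M borel_on S"
    by (rule measurable_pmf_borel_on[OF \<omega>])
  have emp': "empirical S N \<omega> = distr (measure_pmf (pmf_of_set {1..N})) (borel_on S) \<omega>"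
    by (rule empirical_eq_distr[OF N \<omega>])
  have i\<psi>: "integrable J (\<lambda>z. ?\<psi> (snd z))"
    unfolding integrable_distr_eq[OF msnd m\<psi>, symmetric] emp[symmetric] emp'
      integrable_distr_eq[OF m\<omega> m\<psi>]
    using N by (intro integrable_measure_pmf_finite) simp
  have l\<psi>: "(\<integral>z. ?\<psi> (snd z) \<partial>J) = (\<Sum>i = 1..N. \<psi> (\<omega> i)) / N"
    unfolding integral_distr[OF msnd m\<psi>, symmetric] emp[symmetric] emp'
      integral_distr[OF m\<omega> m\<psi>]
    using N by (simp add: integral_pmf_of_set)
  have "AE w in empirical S N \<omega>. w \<in> ?D"
  proof -
    have "{w \<in> space (borel_on S). w \<in> ?D} = ?D"
      using DS by (auto simp: space_restrict_space)
    then have "{w \<in> space (borel_on S). w \<in> ?D} \<in> sets (borel_on S)"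
      using D by simp
    from AE_distr_iff[OF m\<omega> this] show ?thesis
      unfolding emp' using N by (simp add: AE_measure_pmf_iff)
  qed
  then have AE_D: "AE z in J. snd z \<in> ?D"
    unfolding emp by (rule AE_distrD[OF msnd])
  let ?G = "\<lambda>z. ?\<psi> (snd z) - \<rho> * nrm (fst z - snd z)"
  have iG: "integrable J ?G" using i\<psi> icost by simp
  have lb: "AE z in J. ?G z \<le> q (fst z)"
    using AE_D
  proof (rule AE_mp, intro AE_I2 impI)
    fix z assume z: "z \<in> space J" "snd z \<in> ?D"
    then obtain i where i: "i \<in> {1..N}" "snd z = \<omega> i" by auto
    have "fst z \<in> S" using z(1) unfolding spaceJ mem_Times_iff by (rule conjunct1)
    then have "\<psi> (snd z) \<le> \<rho> * nrm (fst z - snd z) + q (fst z)"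
      unfolding i(2) by (rule \<psi>[OF _ i(1)])
    then show "?G z \<le> q (fst z)"
      unfolding if_P[OF z(2)] by linarith
  qed
  show ?thesis
  proof (cases "(\<integral>\<^sup>+ w. ennreal (q w) \<partial>P) = \<infinity>")
    case True
    then show ?thesis
      by (simp add: ereal_expectation_def)
  next
    case False
    have "(\<integral>\<^sup>+ w. ennreal (- q w) \<partial>P) = (\<integral>\<^sup>+ z. ennreal (- q (fst z)) \<partial>J)"
      unfolding P using q by (subst nn_integral_distr[OF mfst]) auto
    also have "\<dots> \<le> (\<integral>\<^sup>+ z. ennreal (norm (?G z)) \<partial>J)"
      using lb by (intro nn_integral_mono_AE) (auto elim!: eventually_mono intro!: ennreal_leI)
    also have "\<dots> < \<infinity>"
      using iG unfolding integrable_iff_bounded by blast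
    finally have iq: "integrable P q"
      using False q unfolding real_integrable_def P by auto
    then have iqJ: "integrable J (\<lambda>z. q (fst z))"
      unfolding P integrable_distr_eq[OF mfst q] .
    have "- c * \<rho> + (\<Sum>i = 1..N. \<psi> (\<omega> i)) / N \<le> (\<integral>z. ?G z \<partial>J)"
      using i\<psi> icost l\<psi> mult_left_mono[OF lcost \<rho>] by (simp add: mult.commute)
    also have "\<dots> \<le> (\<integral>z. q (fst z) \<partial>J)"
      by (rule integral_mono_AE[OF iG iqJ lb])
    also have "\<dots> = (\<integral>w. q w \<partial>P)"
      unfolding P integral_distr[OF mfst q] ..
    finally show ?thesis
      by (simp add: ereal_expectation_eq_integral[OF iq])
  qed
qed

text \<open>The infimum defining the Wasserstein distance need not be attained, so couplings of cost less than
  \<open>\<epsilon> + \<delta>\<close> are used and \<open>\<delta>\<close> tends to \<open>0\<close>.\<close>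

lemma weak_duality:
  fixes nrm :: "'a::euclidean_space \<Rightarrow> real" and q :: "'a \<Rightarrow> real"
  assumes nrm: "is_norm nrm" and N: "N \<ge> 1" and \<omega>: "\<And>i. \<omega> i \<in> S" and \<rho>: "\<rho> \<ge> 0" and \<epsilon>: "\<epsilon> \<ge> 0"
    and q: "q \<in> borel_measurable (borel_on S)"
    and P: "P \<in> wasserstein_ball nrm S (empirical S N \<omega>) \<epsilon>"
  shows "ereal (- \<epsilon> * \<rho>) + (\<Sum>i = 1..N. ereal (1 / real N) *
      (INF w \<in> S. ereal (\<rho> * nrm (w - \<omega> i)) + ereal (q w)))
    \<le> ereal_expectation P (\<lambda>w. ereal (q w))"
proof -
  define \<phi> where "\<phi> w' = (INF w \<in> S. ereal (\<rho> * nrm (w - w')) + ereal (q w))" for w'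
  have le: "\<phi> w' \<le> ereal (\<rho> * nrm (w - w') + q w)" if "w \<in> S" for w w'
    unfolding \<phi>_def using that by (intro INF_lower2[of w]) auto
  have lt: "\<phi> w' < \<infinity>" for w'
    by (rule le_less_trans[OF le[OF \<omega>[of 1]]]) simp
  have "ereal (- \<epsilon> * \<rho>) + (\<Sum>i = 1..N. ereal (1 / real N) * \<phi> (\<omega> i)) \<le> ereal_expectation P (\<lambda>w. ereal (q w))"
  proof (cases "\<exists>j \<in> {1..N}. \<phi> (\<omega> j) = -\<infinity>")
    case True
    then show ?thesis
      using ereal_weighted_sum_MInfty[of _ N "\<lambda>i. \<phi> (\<omega> i)"] lt by auto
  next
    case False
    define \<psi> where "\<psi> w' = real_of_ereal (\<phi> w')" for w'
    have eq: "\<phi> (\<omega> i) = ereal (\<psi> (\<omega> i))" if "i \<in> {1..N}" for i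
      using False lt[of "\<omega> i"] that by (cases "\<phi> (\<omega> i)") (auto simp: \<psi>_def)
    have sum: "ereal (- \<epsilon> * \<rho>) + (\<Sum>i = 1..N. ereal (1 / real N) * \<phi> (\<omega> i)) =
        ereal (- \<epsilon> * \<rho> + (\<Sum>i = 1..N. \<psi> (\<omega> i)) / N)"
      by (simp add: eq sum_divide_distrib)
    have \<psi>: "\<psi> (\<omega> i) \<le> \<rho> * nrm (w - \<omega> i) + q w" if "w \<in> S" "i \<in> {1..N}" for w i
      using le[OF that(1), of "\<omega> i"] unfolding eq[OF that(2)] by simp
    have W: "wasserstein nrm S P (empirical S N \<omega>) \<le> ennreal \<epsilon>"
      using P by (simp add: wasserstein_ball_def)
    have "ereal (- (\<epsilon> + \<delta>) * \<rho> + (\<Sum>i = 1..N. \<psi> (\<omega> i)) / N) \<le> ereal_expectation P (\<lambda>w. ereal (q w))"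
      if \<delta>: "\<delta> > 0" for \<delta>
    proof -
      have "wasserstein nrm S P (empirical S N \<omega>) < ennreal (\<epsilon> + \<delta>)"
        using W \<delta> \<epsilon> by (simp add: le_less_trans ennreal_less_iff)
      then obtain J where "J \<in> couplings S P (empirical S N \<omega>)"
        "(\<integral>\<^sup>+ (w, w'). ennreal (nrm (w - w')) \<partial>J) < ennreal (\<epsilon> + \<delta>)"
        unfolding wasserstein_def INF_less_iff by auto
      then show ?thesis
        using \<delta> \<epsilon> \<psi>
        by (intro weak_duality_coupling[OF nrm N \<omega> \<rho> q]) (auto intro: less_imp_le)
    qed
    then have *: "ereal (- \<epsilon> * \<rho> + (\<Sum>i = 1..N. \<psi> (\<omega> i)) / N) \<le> ereal_expectation P (\<lambda>w. ereal (q w)) + ereal e"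
      if "e > 0" for e
    proof -
      \<comment> \<open>The excess cost \<open>\<delta> = e / (\<rho> + 1)\<close> changes the bound by at most \<open>\<rho> \<delta> \<le> e\<close>.\<close>
      have d: "e / (\<rho> + 1) > 0" using that \<rho> by simp
      have "(e / (\<rho> + 1)) * \<rho> \<le> e" using that \<rho> by (simp add: field_simps)
      then have "ereal (- \<epsilon> * \<rho> + (\<Sum>i = 1..N. \<psi> (\<omega> i)) / N) \<le>
        ereal (- (\<epsilon> + e / (\<rho> + 1)) * \<rho> + (\<Sum>i = 1..N. \<psi> (\<omega> i)) / N) + ereal e"
        by (simp add: algebra_simps)
      also have "\<dots> \<le> ereal_expectation P (\<lambda>w. ereal (q w)) + ereal e"
        by (intro add_right_mono \<open>\<And>\<delta>. \<delta> > 0 \<Longrightarrow> _\<close> d)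
      finally show ?thesis .
    qed
    show ?thesis
      unfolding sum by (rule ereal_le_epsilon2) (use * in auto)
  qed
  then show ?thesis unfolding \<phi>_def .
qed

section \<open>Strong duality\<close>

text \<open>Separation in the plane. A point \<open>b\<close> with \<open>u b > \<epsilon>\<close> forces \<open>\<rho> \<ge> (L - v b) / (u b - \<epsilon>)\<close>, a point
  \<open>a\<close> with \<open>u a < \<epsilon>\<close> forces \<open>\<rho> \<le> (v a - L) / (\<epsilon> - u a)\<close>. Each of the former bounds is at most each of
  the latter, since the segment from \<open>a\<close> to \<open>b\<close> crosses the line \<open>u = \<epsilon>\<close> at a height of at least \<open>L\<close>.
  So the supremum of the lower bounds, and of \<open>0\<close>, is a suitable slope; the Slater point keeps it
  finite.\<close>

lemma planar_multiplier:
  fixes u v :: "'b \<Rightarrow> real"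
  assumes mix: "\<And>a b l. a \<in> A \<Longrightarrow> b \<in> A \<Longrightarrow> 0 \<le> l \<Longrightarrow> l \<le> 1 \<Longrightarrow>
      l * u a + (1 - l) * u b \<le> \<epsilon> \<Longrightarrow> L \<le> l * v a + (1 - l) * v b"
    and slater: "a\<^sub>0 \<in> A" "u a\<^sub>0 < \<epsilon>"
  shows "\<exists>\<rho> \<ge> 0. \<forall>a \<in> A. L + \<rho> * \<epsilon> \<le> v a + \<rho> * u a"
proof -
  define R where "R = insert 0 ((\<lambda>b. (L - v b) / (u b - \<epsilon>)) ` {b \<in> A. u b > \<epsilon>})"
  have below: "L \<le> v a" if "a \<in> A" "u a \<le> \<epsilon>" for a
    using mix[of a a 1] that by simp
  have slope: "r \<le> (v a - L) / (\<epsilon> - u a)" if r: "r \<in> R" and a: "a \<in> A" "u a < \<epsilon>" for r a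
  proof (cases "r = 0")
    case True
    then show ?thesis using below[of a] a by simp
  next
    case False
    then obtain b where b: "b \<in> A" "u b > \<epsilon>" "r = (L - v b) / (u b - \<epsilon>)"
      using r by (auto simp: R_def)
    \<comment> \<open>The weight at which the segment from \<open>a\<close> to \<open>b\<close> crosses \<open>u = \<epsilon>\<close>.\<close>
    define l where "l = (u b - \<epsilon>) / (u b - u a)"
    have d: "u b - u a > 0" using a b by simp
    have l: "0 \<le> l" "l \<le> 1" using a b d by (auto simp: l_def field_simps)
    have l': "1 - l = (\<epsilon> - u a) / (u b - u a)" using d by (simp add: l_def field_simps)
    have "l * u a + (1 - l) * u b = ((u b - \<epsilon>) * u a + (\<epsilon> - u a) * u b) / (u b - u a)"
      unfolding l' by (simp add: l_def add_divide_distrib)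
    also have "\<dots> = \<epsilon>" using d by (simp add: field_simps)
    finally have "L \<le> l * v a + (1 - l) * v b"
      using mix[OF a(1) b(1) l] by simp
    also have "\<dots> = ((u b - \<epsilon>) * v a + (\<epsilon> - u a) * v b) / (u b - u a)"
      unfolding l' by (simp add: l_def add_divide_distrib)
    finally have "L * (u b - u a) \<le> (u b - \<epsilon>) * v a + (\<epsilon> - u a) * v b"
      using d by (simp add: pos_le_divide_eq)
    then have "(L - v b) * (\<epsilon> - u a) \<le> (v a - L) * (u b - \<epsilon>)"
      by (simp add: algebra_simps)
    then show ?thesis
      unfolding b(3) using a(2) b(2) by (simp add: pos_divide_le_eq pos_le_divide_eq)
  qed
  have bdd: "bdd_above R"
    using slope[OF _ slater] by (rule bdd_aboveI)
  have ne: "R \<noteq> {}" by (simp add: R_def)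
  define \<rho> where "\<rho> = Sup R"
  have "0 \<le> \<rho>"
    unfolding \<rho>_def by (rule cSup_upper[OF _ bdd]) (simp add: R_def)
  moreover have "L + \<rho> * \<epsilon> \<le> v a + \<rho> * u a" if a: "a \<in> A" for a
  proof (cases "u a" \<epsilon> rule: linorder_cases)
    case less
    have "\<rho> \<le> (v a - L) / (\<epsilon> - u a)"
      unfolding \<rho>_def using slope a less by (intro cSup_least[OF ne]) auto
    then show ?thesis using less by (simp add: field_simps)
  next
    case equal
    then show ?thesis using below[OF a] by simp
  next
    case greater
    have "(L - v a) / (u a - \<epsilon>) \<le> \<rho>"
      unfolding \<rho>_def using a greater by (intro cSup_upper[OF _ bdd]) (auto simp: R_def)
    then show ?thesis using greater by (simp add: field_simps)
  qed
  ultimately show ?thesis by blast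
qed

text \<open>Minimising a sum of functions of separate variables means minimising every summand. The hypothesis
  also makes every infimum finite: let all but one of the variables stay at \<open>s\<^sub>0\<close>.\<close>

lemma sum_INF_ge:
  fixes g :: "nat \<Rightarrow> 'a \<Rightarrow> real"
  assumes N: "N \<ge> 1" and S: "s\<^sub>0 \<in> S"
    and sel: "\<And>a. (\<And>i. a i \<in> S) \<Longrightarrow> K \<le> (\<Sum>i = 1..N. g i (a i)) / N"
  shows "ereal K \<le> (\<Sum>i = 1..N. ereal (1 / real N) * (INF w \<in> S. ereal (g i w)))"
proof -
  have INF_fin: "\<exists>m. (INF w \<in> S. ereal (g j w)) = ereal m" if j: "j \<in> {1..N}" for j
  proof -
    let ?rest = "\<Sum>i \<in> {1..N} - {j}. g i s\<^sub>0"
    have "ereal (K * N - ?rest) \<le> (INF w \<in> S. ereal (g j w))"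
    proof (rule INF_greatest)
      fix w assume w: "w \<in> S"
      have "K \<le> (\<Sum>i = 1..N. g i (if i = j then w else s\<^sub>0)) / N"
        using w S by (intro sel) auto
      also have "(\<Sum>i = 1..N. g i (if i = j then w else s\<^sub>0)) = g j w + ?rest"
        by (subst sum.remove[OF _ j]) (auto intro!: sum.cong)
      finally show "ereal (K * N - ?rest) \<le> ereal (g j w)"
        using N by (simp add: field_simps)
    qed
    moreover have "(INF w \<in> S. ereal (g j w)) \<le> ereal (g j s\<^sub>0)"
      by (rule INF_lower[OF S])
    ultimately show ?thesis
      by (cases "INF w \<in> S. ereal (g j w)") auto
  qed
  then obtain m where m: "\<And>j. j \<in> {1..N} \<Longrightarrow> (INF w \<in> S. ereal (g j w)) = ereal (m j)"
    by metis
  have "K \<le> (\<Sum>i = 1..N. m i) / N + \<delta>" if \<delta>: "\<delta> > 0" for \<delta>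
  proof -
    have "\<exists>w \<in> S. g j w < m j + \<delta>" if j: "j \<in> {1..N}" for j
    proof -
      have "(INF w \<in> S. ereal (g j w)) < ereal (m j + \<delta>)" using m[OF j] \<delta> by simp
      then show ?thesis unfolding INF_less_iff by auto
    qed
    then obtain a where a: "\<And>j. j \<in> {1..N} \<Longrightarrow> a j \<in> S \<and> g j (a j) < m j + \<delta>"
      by metis
    let ?a = "\<lambda>i. if i \<in> {1..N} then a i else s\<^sub>0"
    have "K \<le> (\<Sum>i = 1..N. g i (?a i)) / N"
      using a S by (intro sel) auto
    also have "\<dots> \<le> (\<Sum>i = 1..N. m i + \<delta>) / N"
      using a by (intro divide_right_mono sum_mono) (auto intro: less_imp_le)
    also have "\<dots> = (\<Sum>i = 1..N. m i) / N + \<delta>"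
      using N by (simp add: sum.distrib add_divide_distrib)
    finally show ?thesis .
  qed
  then have "K \<le> (\<Sum>i = 1..N. m i) / N"
    by (rule field_le_epsilon)
  then show ?thesis
    by (simp add: m sum_divide_distrib)
qed

text \<open>Existence of a multiplier for every lower bound \<open>L\<close> of the primal problem, by \<open>planar_multiplier\<close>
  applied to the average costs and values of the selections; its hypothesis holds because a mixture
  of two selections within the budget belongs to the ball.\<close>

lemma strong_duality:
  fixes nrm :: "'a::euclidean_space \<Rightarrow> real" and q :: "'a \<Rightarrow> real"
  assumes nrm: "is_norm nrm" and N: "N \<ge> 1" and \<omega>: "\<And>i. \<omega> i \<in> S" and \<epsilon>: "\<epsilon> > 0"
    and q: "q \<in> borel_measurable (borel_on S)"
    and L: "\<And>P. P \<in> wasserstein_ball nrm S (empirical S N \<omega>) \<epsilon> \<Longrightarrow>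
      ereal L \<le> ereal_expectation P (\<lambda>w. ereal (q w))"
  shows "\<exists>\<rho> \<ge> 0. ereal L \<le> ereal (- \<epsilon> * \<rho>) + (\<Sum>i = 1..N. ereal (1 / real N) *
      (INF w \<in> S. ereal (\<rho> * nrm (w - \<omega> i)) + ereal (q w)))"
proof -
  let ?A = "{a. \<forall>i::nat. a i \<in> S}"
  let ?u = "\<lambda>a. (\<Sum>i = 1..N. nrm (a i - \<omega> i)) / N" and ?v = "\<lambda>a. (\<Sum>i = 1..N. q (a i)) / N"
  have "\<exists>\<rho> \<ge> 0. \<forall>a \<in> ?A. L + \<rho> * \<epsilon> \<le> ?v a + \<rho> * ?u a"
  proof (rule planar_multiplier)
    fix a b and l :: real
    assume ab: "a \<in> ?A" "b \<in> ?A" and l: "0 \<le> l" "l \<le> 1" and c: "l * ?u a + (1 - l) * ?u b \<le> \<epsilon>"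
    have "mixture S N l a b \<in> wasserstein_ball nrm S (empirical S N \<omega>) \<epsilon>"
      using ab by (intro mixture_in_wasserstein_ball[OF nrm N l \<omega> _ _ c]) auto
    from L[OF this] show "L \<le> l * ?v a + (1 - l) * ?v b"
      using ab by (subst (asm) ereal_expectation_mixture[OF N l _ _ q]) auto
  next
    show "\<omega> \<in> ?A" using \<omega> by simp
    have "nrm 0 = 0" using nrm by (simp add: is_norm_def)
    then show "?u \<omega> < \<epsilon>" using \<epsilon> by simp
  qed
  then obtain \<rho> where \<rho>: "\<rho> \<ge> 0" and mult: "\<And>a. (\<And>i. a i \<in> S) \<Longrightarrow> L + \<rho> * \<epsilon> \<le> ?v a + \<rho> * ?u a"
    by auto
  have "ereal (L + \<rho> * \<epsilon>) \<le> (\<Sum>i = 1..N. ereal (1 / real N) *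
      (INF w \<in> S. ereal (\<rho> * nrm (w - \<omega> i) + q w)))"
  proof (rule sum_INF_ge[OF N \<omega>])
    fix a :: "nat \<Rightarrow> 'a" assume "\<And>i. a i \<in> S"
    then show "L + \<rho> * \<epsilon> \<le> (\<Sum>i = 1..N. \<rho> * nrm (a i - \<omega> i) + q (a i)) / N"
      using mult[of a] by (simp add: sum.distrib add_divide_distrib sum_distrib_left add.commute)
  qed
  then have "ereal (- \<epsilon> * \<rho>) + ereal (L + \<rho> * \<epsilon>) \<le> ereal (- \<epsilon> * \<rho>) + (\<Sum>i = 1..N. ereal (1 / real N) *
      (INF w \<in> S. ereal (\<rho> * nrm (w - \<omega> i) + q w)))"
    by (rule add_left_mono)
  then show ?thesis
    using \<rho> by (intro exI[of _ \<rho>]) (simp add: mult.commute)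
qed

section \<open>Duality for extended-real costs\<close>

text \<open>Moving a small part of every atom to a point \<open>w\<^sub>0\<close> of value \<open>-\<infinity>\<close> stays within the budget, as
  \<open>\<epsilon> > 0\<close>. The positive part of \<open>Q\<close> keeps a finite integral, so the expectation is \<open>-\<infinity>\<close>.\<close>

lemma INF_expectation_eq_MInfty:
  fixes nrm :: "'a::euclidean_space \<Rightarrow> real" and Q :: "'a \<Rightarrow> ereal"
  assumes nrm: "is_norm nrm" and N: "N \<ge> 1" and \<omega>: "\<And>i. \<omega> i \<in> S" and \<epsilon>: "\<epsilon> > 0"
    and Q: "Q \<in> borel_measurable (borel_on S)" and lt: "\<And>w. w \<in> S \<Longrightarrow> Q w < \<infinity>"
    and w\<^sub>0: "w\<^sub>0 \<in> S" "Q w\<^sub>0 = -\<infinity>"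
  shows "(INF P \<in> wasserstein_ball nrm S (empirical S N \<omega>) \<epsilon>. ereal_expectation P Q) = -\<infinity>"
proof -
  define K where "K = (\<Sum>i = 1..N. nrm (w\<^sub>0 - \<omega> i)) / N"
  have K: "K \<ge> 0" unfolding K_def by (intro divide_nonneg_nonneg sum_nonneg is_norm_nonneg[OF nrm]) simp
  \<comment> \<open>The moved mass is \<open>1 - l = \<epsilon> / (\<epsilon> + K) > 0\<close>, at the cost \<open>(1 - l) K = \<epsilon> l \<le> \<epsilon>\<close>.\<close>
  define l where "l = K / (\<epsilon> + K)"
  have l: "0 \<le> l" "l < 1" using K \<epsilon> by (auto simp: l_def)
  have "(1 - l) * K = \<epsilon> * l" using K \<epsilon> by (simp add: l_def field_simps)
  also have "\<dots> \<le> \<epsilon>" using l \<epsilon> by simp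
  finally have "(1 - l) * K \<le> \<epsilon>" .
  moreover have "nrm 0 = 0" using nrm by (simp add: is_norm_def)
  ultimately have ball: "mixture S N l \<omega> (\<lambda>_. w\<^sub>0) \<in> wasserstein_ball nrm S (empirical S N \<omega>) \<epsilon>"
    using l w\<^sub>0(1) \<omega> by (intro mixture_in_wasserstein_ball[OF nrm N]) (auto simp: K_def)
  let ?p = "mixture_pmf N l" and ?g = "\<lambda>(c, i). if c then \<omega> i else w\<^sub>0"
  have g: "?g z \<in> S" for z using \<omega> w\<^sub>0(1) by (auto split: prod.split)
  have fin: "e2ennreal (Q w) < top" if "w \<in> S" for w
    using lt[OF that] by (cases "Q w") (auto simp: e2ennreal_neg)
  have pos: "(\<integral>\<^sup>+ w. e2ennreal (Q w) \<partial>mixture S N l \<omega> (\<lambda>_. w\<^sub>0)) < top"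
    unfolding mixture_def using Q fin
    by (intro nn_integral_distr_finite_less_top finite_set_mixture_pmf[OF N] g) auto
  have "(False, 1) \<in> set_pmf ?p"
    using N l by (auto simp: mixture_pmf_def set_pmf_bernoulli set_pmf_iff pmf_bernoulli_False)
  then have neg: "(\<integral>\<^sup>+ w. e2ennreal (- Q w) \<partial>mixture S N l \<omega> (\<lambda>_. w\<^sub>0)) = top"
    unfolding mixture_def using Q w\<^sub>0(2)
    by (intro nn_integral_distr_eq_top[where i = "(False, 1)"] finite_set_mixture_pmf[OF N] g) auto
  have "ereal_expectation (mixture S N l \<omega> (\<lambda>_. w\<^sub>0)) Q = -\<infinity>"
    unfolding ereal_expectation_def neg using pos
    by (cases "\<integral>\<^sup>+ w. e2ennreal (Q w) \<partial>mixture S N l \<omega> (\<lambda>_. w\<^sub>0)") (auto simp: enn2ereal_ennreal)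
  then show ?thesis
    using INF_lower[OF ball, of "\<lambda>P. ereal_expectation P Q"] by simp
qed

lemma dual_eq_MInfty:
  fixes Q :: "'a::euclidean_space \<Rightarrow> ereal"
  assumes N: "N \<ge> 1" and w\<^sub>0: "w\<^sub>0 \<in> S" "Q w\<^sub>0 = -\<infinity>"
  shows "(SUP \<rho> \<in> {0::real..}. ereal (- \<epsilon> * \<rho>) + (\<Sum>i = 1..N. ereal (1 / real N) *
          (INF w \<in> S. ereal (\<rho> * nrm (w - \<omega> i)) + Q w))) = -\<infinity>"
proof -
  have "(INF w \<in> S. ereal (\<rho> * nrm (w - \<omega> i)) + Q w) = -\<infinity>" for \<rho> i
    using INF_lower[OF w\<^sub>0(1), of "\<lambda>w. ereal (\<rho> * nrm (w - \<omega> i)) + Q w"] w\<^sub>0(2) by simp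
  then have "(\<Sum>i = 1..N. ereal (1 / real N) *
          (INF w \<in> S. ereal (\<rho> * nrm (w - \<omega> i)) + Q w)) = -\<infinity>" for \<rho>
    using N by (intro ereal_weighted_sum_MInfty[of 1]) auto
  then show ?thesis by simp
qed

text \<open>Apart from the degenerate case that \<open>Q\<close> is \<open>-\<infinity>\<close> somewhere, \<open>Q\<close> is real on the support, and
  \<open>weak_duality\<close> and \<open>strong_duality\<close> apply. Comparing with all real \<open>L\<close> below the primal value covers
  an infinite primal value as well.\<close>

lemma wasserstein_ball_duality:
  fixes nrm :: "'a::euclidean_space \<Rightarrow> real" and Q :: "'a \<Rightarrow> ereal"
  assumes nrm: "is_norm nrm" and N: "N \<ge> 1" and \<omega>: "\<And>i. \<omega> i \<in> S" and \<epsilon>: "\<epsilon> > 0"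
    and Q: "Q \<in> borel_measurable (borel_on S)" and lt: "\<And>w. w \<in> S \<Longrightarrow> Q w < \<infinity>"
  shows "(INF P \<in> wasserstein_ball nrm S (empirical S N \<omega>) \<epsilon>. ereal_expectation P Q) =
    (SUP \<rho> \<in> {0::real..}. ereal (- \<epsilon> * \<rho>) + (\<Sum>i = 1..N. ereal (1 / real N) *
          (INF w \<in> S. ereal (\<rho> * nrm (w - \<omega> i)) + Q w)))"
proof (cases "\<exists>w \<in> S. Q w = -\<infinity>")
  case True
  then obtain w\<^sub>0 where "w\<^sub>0 \<in> S" "Q w\<^sub>0 = -\<infinity>" by blast
  then show ?thesis
    using INF_expectation_eq_MInfty[OF nrm N \<omega> \<epsilon> Q lt] dual_eq_MInfty[OF N, of _ S Q \<epsilon> nrm \<omega>]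
    by simp
next
  case False
  define q where "q w = real_of_ereal (Q w)" for w
  have Qq: "Q w = ereal (q w)" if "w \<in> S" for w
    using False lt[OF that] that by (cases "Q w") (auto simp: q_def)
  have q: "q \<in> borel_measurable (borel_on S)"
    unfolding q_def using Q by simp
  let ?B = "wasserstein_ball nrm S (empirical S N \<omega>) \<epsilon>"
  let ?dual = "\<lambda>\<rho>. ereal (- \<epsilon> * \<rho>) + (\<Sum>i = 1..N. ereal (1 / real N) *
          (INF w \<in> S. ereal (\<rho> * nrm (w - \<omega> i)) + Q w))"
  have INF_q: "(INF w \<in> S. ereal (\<rho> * nrm (w - \<omega> i)) + Q w) =
      (INF w \<in> S. ereal (\<rho> * nrm (w - \<omega> i)) + ereal (q w))" for \<rho> i
    by (intro INF_cong refl) (simp add: Qq)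
  have E_q: "ereal_expectation P Q = ereal_expectation P (\<lambda>w. ereal (q w))" if "P \<in> ?B" for P
    using that Qq by (intro ereal_expectation_cong_real) (auto simp: wasserstein_ball_def prob_distributions_def)
  show ?thesis
  proof (rule antisym)
    show "(INF P \<in> ?B. ereal_expectation P Q) \<le> (SUP \<rho> \<in> {0..}. ?dual \<rho>)"
    proof (rule dense_le)
      fix y assume y: "y < (INF P \<in> ?B. ereal_expectation P Q)"
      show "y \<le> (SUP \<rho> \<in> {0..}. ?dual \<rho>)"
      proof (cases y)
        case (real L)
        have "ereal L \<le> ereal_expectation P (\<lambda>w. ereal (q w))" if "P \<in> ?B" for P
          using INF_lower[OF that, of "\<lambda>P. ereal_expectation P Q"] y real E_q[OF that] by simp
        then have "\<exists>\<rho> \<ge> 0. ereal L \<le> ?dual \<rho>"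
          unfolding INF_q by (rule strong_duality[OF nrm N \<omega> \<epsilon> q])
        then obtain \<rho> where "\<rho> \<ge> 0" "ereal L \<le> ?dual \<rho>"
          by (elim exE conjE)
        then show ?thesis
          unfolding real by (intro SUP_upper2[of \<rho>]) auto
      qed (use y in auto)
    qed
    show "(SUP \<rho> \<in> {0..}. ?dual \<rho>) \<le> (INF P \<in> ?B. ereal_expectation P Q)"
      unfolding INF_q
      using weak_duality[OF nrm N \<omega> _ _ q] \<epsilon> E_q by (intro SUP_least INF_greatest) auto
  qed
qed

section \<open>The cost-to-go functions\<close>

text \<open>Backward induction on the stage: one feasible decision has a finite cost of its own and, by the
  induction hypothesis, an expected cost-to-go below \<open>\<infinity>\<close>. The value \<open>-\<infinity>\<close> cannot be excluded before
  the last stage, since the infimum over an ambiguity set may be unbounded below.\<close>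

lemma Q_RR_less_top:
  fixes n :: "nat \<Rightarrow> nat"
  assumes X_nonempty: "\<And>s y w. s \<in> {2..T} \<Longrightarrow> y \<in> topspace (Euclidean_space (n (s - 1))) \<Longrightarrow>
          w \<in> \<Omega> s \<Longrightarrow> X s y w \<noteq> {}"
    and X_space: "\<And>s y w. s \<in> {2..T} \<Longrightarrow> y \<in> topspace (Euclidean_space (n (s - 1))) \<Longrightarrow>
          w \<in> \<Omega> s \<Longrightarrow> X s y w \<subseteq> topspace (Euclidean_space (n s))"
    and expected: "\<And>s y. s \<in> {2..T} \<Longrightarrow> y \<in> topspace (Euclidean_space (n (s - 1))) \<Longrightarrow>
          (\<And>w. w \<in> \<Omega> s \<Longrightarrow> Q_RR T X f Amb s y w < \<infinity>) \<Longrightarrow> expected_Q_RR T X f Amb s y < \<infinity>"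
    and s: "s \<in> {2..T}" and y: "y \<in> topspace (Euclidean_space (n (s - 1)))" and w: "w \<in> \<Omega> s"
  shows "Q_RR T X f Amb s y w < \<infinity>"
  using s y w
proof (induction "T - s" arbitrary: s y w rule: less_induct)
  case less
  obtain z where z: "z \<in> X s y w"
    using X_nonempty[OF less.prems] by blast
  have zn: "z \<in> topspace (Euclidean_space (n s))"
    using z X_space[OF less.prems] by blast
  show ?case
  proof (cases "s = T")
    case True
    have "Q_RR T X f Amb s y w \<le> ereal (f s z w)"
      using z unfolding True Q_RR_last by (rule INF_lower)
    then show ?thesis by (rule le_less_trans) simp
  next
    case False
    then have sT: "s < T" and s': "Suc s \<in> {2..T}" using less.prems(1) by auto
    have "expected_Q_RR T X f Amb (Suc s) z < \<infinity>"
      using zn less.hyps[OF _ s'] sT by (intro expected[OF s']) auto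
    moreover have "Q_RR T X f Amb s y w \<le> ereal (f s z w) + expected_Q_RR T X f Amb (Suc s) z"
      using z unfolding Q_RR_step[OF sT] by (rule INF_lower)
    ultimately show ?thesis
      by (cases "expected_Q_RR T X f Amb (Suc s) z") (auto intro: le_less_trans)
  qed
qed

theorem proposition1:
  fixes T t :: nat
    and n :: "nat \<Rightarrow> nat"
    and I :: "nat \<Rightarrow> nat set"
    and nrm :: "real ^ 'd \<Rightarrow> real"
    and \<Omega> :: "nat \<Rightarrow> (real ^ 'd) set"
    and N :: "nat \<Rightarrow> nat"
    and \<omega> :: "nat \<Rightarrow> nat \<Rightarrow> real ^ 'd"
    and X :: "nat \<Rightarrow> dvec \<Rightarrow> real ^ 'd \<Rightarrow> dvec set"
    and f :: "nat \<Rightarrow> dvec \<Rightarrow> real ^ 'd \<Rightarrow> real"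
    and \<epsilon> :: "nat \<Rightarrow> dvec \<Rightarrow> real"
    and Amb :: "nat \<Rightarrow> dvec \<Rightarrow> (real ^ 'd) measure set"
    and x :: dvec
  assumes nrm: "is_norm nrm"
    and N_pos: "\<And>s. s \<in> {2..T} \<Longrightarrow> N s \<ge> 1"
    and data: "\<And>s i. s \<in> {2..T} \<Longrightarrow> i \<in> {1..N s} \<Longrightarrow> \<omega> s i \<in> \<Omega> s"
    and X_nonempty: "\<And>s y w. s \<in> {2..T} \<Longrightarrow> y \<in> topspace (Euclidean_space (n (s - 1))) \<Longrightarrow>
          w \<in> \<Omega> s \<Longrightarrow> X s y w \<noteq> {}"
    and X_compact: "\<And>s y w. s \<in> {2..T} \<Longrightarrow> y \<in> topspace (Euclidean_space (n (s - 1))) \<Longrightarrow>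
          w \<in> \<Omega> s \<Longrightarrow> compactin (Euclidean_space (n s)) (X s y w)"
    and X_mixed_integer: "\<And>s y w. s \<in> {2..T} \<Longrightarrow> y \<in> topspace (Euclidean_space (n (s - 1))) \<Longrightarrow>
          w \<in> \<Omega> s \<Longrightarrow> mixed_integer_set (n s) (I s) (X s y w)"
    and f_linear: "\<And>s w. s \<in> {2..T} \<Longrightarrow> w \<in> \<Omega> s \<Longrightarrow> linear_on_Rn (n s) (\<lambda>y. f s y w)"
    and \<epsilon>_pos: "\<And>s y. s \<in> {2..T} \<Longrightarrow> y \<in> topspace (Euclidean_space (n (s - 1))) \<Longrightarrow> \<epsilon> s y > 0"
    and Amb: "\<And>s y. s \<in> {2..T} \<Longrightarrow> y \<in> topspace (Euclidean_space (n (s - 1))) \<Longrightarrow>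
          Amb s y = wasserstein_ball nrm (\<Omega> s) (empirical (\<Omega> s) (N s) (\<omega> s)) (\<epsilon> s y)"
    and expectations: "\<And>s y P. s \<in> {2..T} \<Longrightarrow> y \<in> topspace (Euclidean_space (n (s - 1))) \<Longrightarrow>
          P \<in> Amb s y \<Longrightarrow> expectation_well_defined P (Q_RR T X f Amb s y)"
    and t: "t \<in> {2..T}"
    and x: "x \<in> topspace (Euclidean_space (n (t - 1)))"
  shows "expected_Q_RR T X f Amb t x =
    (SUP \<rho> \<in> {0::real..}.
       ereal (- \<epsilon> t x * \<rho>) +
       (\<Sum>i = 1..N t. ereal (1 / real (N t)) *
          (INF w \<in> \<Omega> t. ereal (\<rho> * nrm (w - \<omega> t i)) + Q_RR T X f Amb t x w)))"
proof -
  \<comment> \<open>The entries outside the index range are arbitrary; sending them to a data point makes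
    \<open>\<omega>' s\<close> a map into the support, as images of discrete measures require.\<close>
  define \<omega>' where "\<omega>' s i = (if i \<in> {1..N s} then \<omega> s i else \<omega> s 1)" for s i
  have \<omega>': "\<omega>' s i \<in> \<Omega> s" if "s \<in> {2..T}" for s i
    using data[OF that] N_pos[OF that] by (auto simp: \<omega>'_def)
  have emp_eq: "empirical (\<Omega> s) (N s) (\<omega> s) = empirical (\<Omega> s) (N s) (\<omega>' s)" for s
    by (rule empirical_cong) (simp add: \<omega>'_def)
  have emp: "empirical (\<Omega> s) (N s) (\<omega>' s) \<in> Amb s y"
    and meas: "Q_RR T X f Amb s y \<in> borel_measurable (borel_on (\<Omega> s))"
    if s: "s \<in> {2..T}" and y: "y \<in> topspace (Euclidean_space (n (s - 1)))" for s y
  proof -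
    show emp: "empirical (\<Omega> s) (N s) (\<omega>' s) \<in> Amb s y"
      unfolding Amb[OF s y] emp_eq using \<epsilon>_pos[OF s y]
      by (intro empirical_in_wasserstein_ball[OF nrm N_pos[OF s] \<omega>'[OF s]]) auto
    show "Q_RR T X f Amb s y \<in> borel_measurable (borel_on (\<Omega> s))"
      using expectations[OF s y emp]
      by (simp add: expectation_well_defined_def measurable_cong_sets[OF sets_empirical refl])
  qed
  have lt: "Q_RR T X f Amb t x w < \<infinity>" if "w \<in> \<Omega> t" for w
  proof (rule Q_RR_less_top[where n = n and \<Omega> = \<Omega> and X = X, OF X_nonempty])
    fix s y
    assume s: "s \<in> {2..T}" and y: "y \<in> topspace (Euclidean_space (n (s - 1)))"
    show "X s y w \<subseteq> topspace (Euclidean_space (n s))" if "w \<in> \<Omega> s" for w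
      using X_compact[OF s y that] by (rule compactin_subset_topspace)
    assume fin: "\<And>w. w \<in> \<Omega> s \<Longrightarrow> Q_RR T X f Amb s y w < \<infinity>"
    have "expected_Q_RR T X f Amb s y
        \<le> ereal_expectation (empirical (\<Omega> s) (N s) (\<omega>' s)) (Q_RR T X f Amb s y)"
      unfolding expected_Q_RR_def by (rule INF_lower[OF emp[OF s y]])
    also have "\<dots> < \<infinity>"
      by (rule ereal_expectation_empirical_less_top[OF N_pos[OF s] \<omega>'[OF s] meas[OF s y] fin])
    finally show "expected_Q_RR T X f Amb s y < \<infinity>" .
  qed (use t x that in auto)
  have "expected_Q_RR T X f Amb t x =
    (SUP \<rho> \<in> {0::real..}. ereal (- \<epsilon> t x * \<rho>) + (\<Sum>i = 1..N t. ereal (1 / real (N t)) *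
          (INF w \<in> \<Omega> t. ereal (\<rho> * nrm (w - \<omega>' t i)) + Q_RR T X f Amb t x w)))"
    unfolding expected_Q_RR_def Amb[OF t x] emp_eq
    by (rule wasserstein_ball_duality[OF nrm N_pos[OF t] \<omega>'[OF t] \<epsilon>_pos[OF t x] meas[OF t x] lt])
  then show ?thesis
    by (simp add: \<omega>'_def)
qed

end
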